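(* Fix auxiliary values $\gamma_{c,j},y_{c,j},\gamma_{p,j},y_{p,j}\ge 0$ for $j\in\mathcal J$, and $\nu\ge 0$. Then, with $\hat R_{c,j},\hat R_{p,j},\hat N,D,e_i,P_i^{\mathrm{load}}$ as defined in the context, the problem of maximizing $$V\left[2\nu\sqrt{\hat N(p,t)}-\nu^2D(p)\right]-\Delta\sum_{i\in\mathcal S} Z_i\,P_i^{\mathrm{load}}(p)$$ over $p=(p_c,p_1,\ldots,p_U)$, $t=(t_1,\ldots,t_U)$ and $r_c\in\mathbb R$, subject to $$r_c\le\hat R_{c,k}(p)\ \ \forall k\in\mathcal J,\qquad t_j+\hat R_{p,j}(p)\ge R_j^{\min}\ \ \forall j\in\mathcal J,$$ $$0\le e_i(p)\le e_i^{\max}\ \ \forall i\in\mathcal S,\qquad \sum_{j\in\mathcal J}t_j\le r_c,\qquad p_c\ge0,\ p_j\ge 0,\ t_j\ge0\ \ \forall j\in\mathcal J,$$ is a convex optimization problem, i.e. the maximization of a concave objective over a convex feasible set.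
   Context: A cluster of satellites $\mathcal S=\{1,\ldots,K\}$ serves users $\mathcal J=\{1,\ldots,U\}$ in a fixed time slot. Given constants: scalar channel gains $h_j\ge0$, noise power $\sigma^2>0$, bandwidth $W>0$, power shares $\xi_i\ge0$ with $\sum_i\xi_i=1$, amplifier efficiencies $\eta_i>0$, bus loads $P_i^{\mathrm{bus}}$, fixed circuit loads $P_i^{\mathrm{fix}}$, $P_0=\sum_iP_i^{\mathrm{fix}}$, slot duration $\Delta>0$, weight $V>0$, real queue weights $Z_i$ (of any sign), QoS floors $R_j^{\min}\ge0$, and real power limits $e_i^{\max}$. The variables are the common-stream power $p_c$, private-stream powers $p_j$, common-rate portions $t_j$ and common rate $r_c$. Define the affine functions $$e_i(p)=\frac{\xi_i}{\eta_i}\Big(p_c+\sum_{j}p_j\Big),\quad P_i^{\mathrm{load}}(p)=P_i^{\mathrm{bus}}+P_i^{\mathrm{fix}}+e_i(p),\quad D(p)=P_0+\sum_ie_i(p),$$ and $$S_{c,j}=p_ch_j,\quad I_{c,j}=h_j\sum_{k}p_k+\sigma^2,\quad S_{p,j}=p_jh_j,\quad I_{p,j}=h_j\sum_{k\ne j}p_k+\sigma^2,$$ where sums over $k$ run over $\mathcal J$ (private powers only). For $s\in\{c,p\}$ the transformed rates are $$\hat R_{s,j}(p)=\log_2(1+\gamma_{s,j})-\frac{\gamma_{s,j}}{\ln2}+\frac{1+\gamma_{s,j}}{\ln2}\Big[2y_{s,j}\sqrt{S_{s,j}}-y_{s,j}^2(S_{s,j}+I_{s,j})\Big],$$ and $\hat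 N(p,t)=W\sum_{j}(t_j+\hat R_{p,j}(p))$. Since $R_j^{\min}\ge0$, every feasible point has $\hat N\ge0$, so $\sqrt{\hat N}$ is defined on the feasible set. *)

theory Defs
  imports "HOL-Analysis.Analysis"
begin

text \<open>
  Satellites and users are indexed by the finite types \<open>'s\<close> and \<open>'u\<close>, so that the decision
  variables \<open>(pc, p, t, rc)\<close> live in the real vector space \<open>real \<times> (real^'u) \<times> (real^'u) \<times> real\<close>.
\<close>

datatype stream = Common | Private

record ('s, 'u) cluster =
  gain :: "'u \<Rightarrow> real"            \<comment> \<open>\<open>h\<^sub>j\<close>\<close>
  noise :: real                     \<comment> \<open>the noise power \<open>\<sigma>\<^sup>2\<close> itself, not its square root\<close>
  bandwidth :: real                 \<comment> \<open>\<open>W\<close>\<close>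
  share :: "'s \<Rightarrow> real"           \<comment> \<open>\<open>\<xi>\<^sub>i\<close>\<close>
  amp_eff :: "'s \<Rightarrow> real"         \<comment> \<open>\<open>\<eta>\<^sub>i\<close>\<close>
  bus_load :: "'s \<Rightarrow> real"
  fix_load :: "'s \<Rightarrow> real"
  slot :: real                      \<comment> \<open>\<open>\<Delta>\<close>\<close>
  weight :: real                    \<comment> \<open>\<open>V\<close>\<close>
  queue :: "'s \<Rightarrow> real"           \<comment> \<open>\<open>Z\<^sub>i\<close>\<close>
  min_rate :: "'u \<Rightarrow> real"
  max_power :: "'s \<Rightarrow> real"

definition tx_power :: "('s, 'u::finite) cluster \<Rightarrow> 's \<Rightarrow> real \<Rightarrow> real^'u \<Rightarrow> real" where
  "tx_power C i pc p = share C i / amp_eff C i * (pc + (\<Sum>j\<in>UNIV. p $ j))"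

definition load_power :: "('s, 'u::finite) cluster \<Rightarrow> 's \<Rightarrow> real \<Rightarrow> real^'u \<Rightarrow> real" where
  "load_power C i pc p = bus_load C i + fix_load C i + tx_power C i pc p"

definition total_power :: "('s::finite, 'u::finite) cluster \<Rightarrow> real \<Rightarrow> real^'u \<Rightarrow> real" where
  "total_power C pc p = (\<Sum>i\<in>UNIV. fix_load C i) + (\<Sum>i\<in>UNIV. tx_power C i pc p)"

definition signal ::
  "('s, 'u::finite) cluster \<Rightarrow> stream \<Rightarrow> 'u \<Rightarrow> real \<Rightarrow> real^'u \<Rightarrow> real" where
  "signal C s j pc p =
    (case s of Common \<Rightarrow> pc * gain C j | Private \<Rightarrow> p $ j * gain C j)"

definition interference ::
  "('s, 'u::finite) cluster \<Rightarrow> stream \<Rightarrow> 'u \<Rightarrow> real^'u \<Rightarrow> real" where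
  "interference C s j p =
    (case s of
       Common \<Rightarrow> gain C j * (\<Sum>k\<in>UNIV. p $ k) + noise C
     | Private \<Rightarrow> gain C j * (\<Sum>k\<in>UNIV - {j}. p $ k) + noise C)"

definition rate ::
  "('s, 'u::finite) cluster \<Rightarrow> (stream \<Rightarrow> 'u \<Rightarrow> real) \<Rightarrow> (stream \<Rightarrow> 'u \<Rightarrow> real) \<Rightarrow>
     stream \<Rightarrow> 'u \<Rightarrow> real \<Rightarrow> real^'u \<Rightarrow> real" where
  "rate C \<gamma> y s j pc p =
    log 2 (1 + \<gamma> s j) - \<gamma> s j / ln 2
    + (1 + \<gamma> s j) / ln 2
      * (2 * y s j * sqrt (signal C s j pc p)
         - (y s j)\<^sup>2 * (signal C s j pc p + interference C s j p))"

definition total_rate ::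
  "('s, 'u::finite) cluster \<Rightarrow> (stream \<Rightarrow> 'u \<Rightarrow> real) \<Rightarrow> (stream \<Rightarrow> 'u \<Rightarrow> real) \<Rightarrow>
     real \<Rightarrow> real^'u \<Rightarrow> real^'u \<Rightarrow> real" where
  "total_rate C \<gamma> y pc p t =
    bandwidth C * (\<Sum>j\<in>UNIV. t $ j + rate C \<gamma> y Private j pc p)"

definition objective ::
  "('s::finite, 'u::finite) cluster \<Rightarrow> (stream \<Rightarrow> 'u \<Rightarrow> real) \<Rightarrow> (stream \<Rightarrow> 'u \<Rightarrow> real) \<Rightarrow> real \<Rightarrow>
     real \<times> (real^'u) \<times> (real^'u) \<times> real \<Rightarrow> real" where
  "objective C \<gamma> y \<nu> = (\<lambda>(pc, p, t, rc).
    weight C * (2 * \<nu> * sqrt (total_rate C \<gamma> y pc p t) - \<nu>\<^sup>2 * total_power C pc p)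
    - slot C * (\<Sum>i\<in>UNIV. queue C i * load_power C i pc p))"

definition feasible_set ::
  "('s, 'u::finite) cluster \<Rightarrow> (stream \<Rightarrow> 'u \<Rightarrow> real) \<Rightarrow> (stream \<Rightarrow> 'u \<Rightarrow> real) \<Rightarrow>
     (real \<times> (real^'u) \<times> (real^'u) \<times> real) set" where
  "feasible_set C \<gamma> y = {(pc, p, t, rc).
     (\<forall>k. rc \<le> rate C \<gamma> y Common k pc p) \<and>
     (\<forall>j. t $ j + rate C \<gamma> y Private j pc p \<ge> min_rate C j) \<and>
     (\<forall>i. 0 \<le> tx_power C i pc p \<and> tx_power C i pc p \<le> max_power C i) \<and>
     (\<Sum>j\<in>UNIV. t $ j) \<le> rc \<and>
     pc \<ge> 0 \<and> (\<forall>j. p $ j \<ge> 0) \<and> (\<forall>j. t $ j \<ge> 0)}"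

text \<open>
  HOL's \<^const>\<open>sqrt\<close> is total (an odd function), so the next two facts record that on the feasible
  set it is only ever applied to nonnegative arguments.
\<close>

lemma feasible_signal_nonneg:
  assumes "\<And>j. gain C j \<ge> 0" and "(pc, p, t, rc) \<in> feasible_set C \<gamma> y"
  shows "signal C s j pc p \<ge> 0"
  using assms by (cases s) (auto simp: feasible_set_def signal_def)

lemma feasible_total_rate_nonneg:
  assumes "bandwidth C > 0" and "\<And>j. min_rate C j \<ge> 0"
    and "(pc, p, t, rc) \<in> feasible_set C \<gamma> y"
  shows "total_rate C \<gamma> y pc p t \<ge> 0"
proof -
  have "t $ j + rate C \<gamma> y Private j pc p \<ge> 0" for j
  proof -
    have "t $ j + rate C \<gamma> y Private j pc p \<ge> min_rate C j"
      using assms(3) unfolding feasible_set_def by blast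
    then show ?thesis using assms(2)[of j] by linarith
  qed
  then show ?thesis
    using assms(1) unfolding total_rate_def by (intro mult_nonneg_nonneg sum_nonneg) auto
qed

end

theory Submission
  imports Defs
begin

text \<open>Signals, interference, transmit powers, loads and total power are all affine in the
  powers. Each transformed rate is a constant plus a nonnegative multiple of 2y sqrt(S) - y^2 (S +
  I), with S and I affine and y >= 0; since the square root is concave on the nonnegative reals, the
  rate is concave wherever S >= 0 (\<open>rate_combination_ge\<close>). Every constraint is then
  affine or bounds a concave function from below, which makes the feasible set convex
  (\<open>convex_feasible_set\<close>). The total rate is concave and nonnegative there
  (\<open>total_rate_combination_ge\<close>, \<open>feasible_total_rate_nonneg\<close>), so its
  square root, a nondecreasing concave function of it, is concave. The rest of the objective is
  affine, so the queue weights may have any sign.\<close>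

lemma sqrt_convex_combination_ge:
  fixes a b u v :: real
  assumes "a \<ge> 0" "b \<ge> 0" "u \<ge> 0" "v \<ge> 0" "u + v = 1"
  shows "u * sqrt a + v * sqrt b \<le> sqrt (u * a + v * b)"
proof (rule real_le_rsqrt)
  have v: "v = 1 - u" using assms(5) by simp
  have "u * a + v * b - (u * sqrt a + v * sqrt b)\<^sup>2
      = u * (sqrt a)\<^sup>2 + v * (sqrt b)\<^sup>2 - (u * sqrt a + v * sqrt b)\<^sup>2"
    using assms by simp
  \<comment> \<open>The variance of a two-point distribution: mean of squares minus square of the
    mean. Eliminating \<open>v\<close> turns this into a polynomial identity.\<close>
  also have "\<dots> = u * v * (sqrt a - sqrt b)\<^sup>2"
    unfolding v by algebra
  also have "\<dots> \<ge> 0" using assms by simp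
  finally show "(u * sqrt a + v * sqrt b)\<^sup>2 \<le> u * a + v * b" by simp
qed

text \<open>Transmit power is homogeneous linear, so the weights are arbitrary here; the affine
  quantities below carry constant terms and need \<open>u + v = 1\<close>.\<close>

lemma tx_power_combination:
  "tx_power C i (u * pc + v * pc') (u *\<^sub>R p + v *\<^sub>R p')
    = u * tx_power C i pc p + v * tx_power C i pc' p'"
  unfolding tx_power_def
  by (simp add: sum.distrib flip: sum_distrib_left) (simp add: algebra_simps add_divide_distrib)

lemma load_power_combination:
  assumes "u + v = 1"
  shows "load_power C i (u * pc + v * pc') (u *\<^sub>R p + v *\<^sub>R p')
    = u * load_power C i pc p + v * load_power C i pc' p'"
proof -
  have v: "v = 1 - u" using assms by simp
  show ?thesis
    unfolding load_power_def tx_power_combination v by (simp add: algebra_simps)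
qed

lemma total_power_combination:
  assumes "u + v = 1"
  shows "total_power C (u * pc + v * pc') (u *\<^sub>R p + v *\<^sub>R p')
    = u * total_power C pc p + v * total_power C pc' p'"
proof -
  have v: "v = 1 - u" using assms by simp
  show ?thesis
    unfolding total_power_def tx_power_combination sum.distrib sum_distrib_left[symmetric] v
    by (simp add: algebra_simps)
qed

lemma signal_combination:
  "signal C s j (u * pc + v * pc') (u *\<^sub>R p + v *\<^sub>R p')
    = u * signal C s j pc p + v * signal C s j pc' p'"
  unfolding signal_def by (cases s) (simp_all add: algebra_simps)

lemma interference_combination:
  assumes "u + v = 1"
  shows "interference C s j (u *\<^sub>R p + v *\<^sub>R p')
    = u * interference C s j p + v * interference C s j p'"
proof -
  have v: "v = 1 - u" using assms by simp
  show ?thesis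
    unfolding interference_def v
    by (cases s) (simp_all add: sum.distrib flip: sum_distrib_left, simp_all add: algebra_simps)
qed

text \<open>Only the square root fails to be affine, and it enters with the nonnegative factor 2y(1
  + \<open>\<gamma>\<close>)/ln 2. The signals must be nonnegative because \<open>sqrt\<close>,
  extended as an odd function, is not concave on the whole line.\<close>

lemma rate_combination_ge:
  assumes "\<gamma> s j \<ge> 0" "y s j \<ge> 0"
    and "signal C s j pc p \<ge> 0" "signal C s j pc' p' \<ge> 0"
    and "u \<ge> 0" "v \<ge> 0" "u + v = 1"
  shows "u * rate C \<gamma> y s j pc p + v * rate C \<gamma> y s j pc' p'
    \<le> rate C \<gamma> y s j (u * pc + v * pc') (u *\<^sub>R p + v *\<^sub>R p')"
proof -
  let ?S = "signal C s j pc p" and ?S' = "signal C s j pc' p'"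
  let ?I = "interference C s j p" and ?I' = "interference C s j p'"
  let ?k = "log 2 (1 + \<gamma> s j) - \<gamma> s j / ln 2" and ?c = "(1 + \<gamma> s j) / ln 2" and ?y = "y s j"
  have v: "v = 1 - u" using assms by simp
  have "u * (?k + ?c * (2 * ?y * sqrt ?S - ?y\<^sup>2 * (?S + ?I)))
      + v * (?k + ?c * (2 * ?y * sqrt ?S' - ?y\<^sup>2 * (?S' + ?I')))
    = ?k + ?c * (2 * ?y * (u * sqrt ?S + v * sqrt ?S')
        - ?y\<^sup>2 * ((u * ?S + v * ?S') + (u * ?I + v * ?I')))"
    unfolding v by algebra
  \<comment> \<open>The sign conditions on \<open>\<gamma>\<close> and \<open>y\<close> are used
    here: both factors in front of the root must be nonnegative.\<close>
  also have "\<dots> \<le> ?k + ?c * (2 * ?y * sqrt (u * ?S + v * ?S')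
        - ?y\<^sup>2 * ((u * ?S + v * ?S') + (u * ?I + v * ?I')))"
    using assms
    by (intro add_left_mono mult_left_mono diff_right_mono sqrt_convex_combination_ge) auto
  finally show ?thesis
    unfolding rate_def signal_combination interference_combination[OF assms(7)] .
qed

text \<open>A nonnegative multiple of a sum of concave rates and linear terms in \<open>t\<close> is
  jointly concave in powers and rate portions.\<close>

lemma total_rate_combination_ge:
  assumes "bandwidth C \<ge> 0"
    and "\<And>j. \<gamma> Private j \<ge> 0" "\<And>j. y Private j \<ge> 0"
    and "\<And>j. signal C Private j pc p \<ge> 0" "\<And>j. signal C Private j pc' p' \<ge> 0"
    and "u \<ge> 0" "v \<ge> 0" "u + v = 1"
  shows "u * total_rate C \<gamma> y pc p t + v * total_rate C \<gamma> y pc' p' t'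
    \<le> total_rate C \<gamma> y (u * pc + v * pc') (u *\<^sub>R p + v *\<^sub>R p') (u *\<^sub>R t + v *\<^sub>R t')"
proof -
  let ?R = "\<lambda>j. rate C \<gamma> y Private j pc p" and ?R' = "\<lambda>j. rate C \<gamma> y Private j pc' p'"
  have "u * total_rate C \<gamma> y pc p t + v * total_rate C \<gamma> y pc' p' t'
    = bandwidth C * (\<Sum>j\<in>UNIV. (u * t $ j + v * t' $ j) + (u * ?R j + v * ?R' j))"
    unfolding total_rate_def sum.distrib sum_distrib_left[symmetric] by (simp add: algebra_simps)
  also have "\<dots> \<le> bandwidth C * (\<Sum>j\<in>UNIV. (u *\<^sub>R t + v *\<^sub>R t') $ j
      + rate C \<gamma> y Private j (u * pc + v * pc') (u *\<^sub>R p + v *\<^sub>R p'))"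
    using assms by (intro mult_left_mono sum_mono add_mono rate_combination_ge) auto
  finally show ?thesis unfolding total_rate_def .
qed

text \<open>The constraints with rates describe superlevel sets of concave functions, since
  \<open>rc\<close> and \<open>t\<close> enter linearly; all the others are affine
  inequalities.\<close>

lemma convex_feasible_set:
  fixes C :: "('s, 'u::finite) cluster"
  assumes gain: "\<And>j. gain C j \<ge> 0"
    and "\<And>s j. \<gamma> s j \<ge> 0" "\<And>s j. y s j \<ge> 0"
  shows "convex (feasible_set C \<gamma> y)"
proof (rule convexI)
  fix x x' :: "real \<times> (real^'u) \<times> (real^'u) \<times> real" and u v :: real
  assume x: "x \<in> feasible_set C \<gamma> y" and x': "x' \<in> feasible_set C \<gamma> y"
    and uv: "u \<ge> 0" "v \<ge> 0" "u + v = 1"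
  obtain pc p t rc where x_eq: "x = (pc, p, t, rc)" by (cases x) auto
  obtain pc' p' t' rc' where x'_eq: "x' = (pc', p', t', rc')" by (cases x') auto
  note mem = x[unfolded x_eq] and mem' = x'[unfolded x'_eq]
  note f = mem[unfolded feasible_set_def, simplified] and f' = mem'[unfolded feasible_set_def, simplified]
  \<comment> \<open>Adds the same inequality at the two points, weighted by \<open>u\<close> and
    \<open>v\<close>.\<close>
  note comb = add_mono[OF mult_left_mono[OF _ uv(1)] mult_left_mono[OF _ uv(2)]]
  have rate: "u * rate C \<gamma> y s j pc p + v * rate C \<gamma> y s j pc' p'
      \<le> rate C \<gamma> y s j (u * pc + v * pc') (u *\<^sub>R p + v *\<^sub>R p')" for s j
    using assms uv feasible_signal_nonneg[OF gain mem] feasible_signal_nonneg[OF gain mem']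
    by (intro rate_combination_ge) auto
  have const: "u * m + v * m = m" for m :: real
    using uv(3) by (simp flip: distrib_right)
  have "u * rc + v * rc' \<le> rate C \<gamma> y Common k (u * pc + v * pc') (u *\<^sub>R p + v *\<^sub>R p')" for k
    \<comment> \<open>The intermediate term is the weighted mean of the two endpoint rates.\<close>
    using comb f f' by (intro order_trans[OF _ rate]) blast
  moreover have "min_rate C j \<le> (u * t $ j + v * t' $ j)
      + rate C \<gamma> y Private j (u * pc + v * pc') (u *\<^sub>R p + v *\<^sub>R p')" for j
  proof -
    have "u * min_rate C j + v * min_rate C j
      \<le> u * (t $ j + rate C \<gamma> y Private j pc p) + v * (t' $ j + rate C \<gamma> y Private j pc' p')"
      using comb f f' by blast
    with rate[of Private j] show ?thesis by (simp add: const distrib_left)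
  qed
  moreover have "0 \<le> u * tx_power C i pc p + v * tx_power C i pc' p'" for i
    using f f' uv by simp
  moreover have "u * tx_power C i pc p + v * tx_power C i pc' p' \<le> max_power C i" for i
    using comb[of "tx_power C i pc p" "max_power C i" "tx_power C i pc' p'" "max_power C i"] f f'
    by (simp add: const)
  moreover have "(\<Sum>j\<in>UNIV. u * t $ j + v * t' $ j) \<le> u * rc + v * rc'"
    using comb f f' by (simp add: sum.distrib flip: sum_distrib_left)
  ultimately show "u *\<^sub>R x + v *\<^sub>R x' \<in> feasible_set C \<gamma> y"
    using f f' uv unfolding x_eq x'_eq feasible_set_def
    by (simp add: tx_power_combination)
qed

theorem proposition2:
  fixes C :: "('s::finite, 'u::finite) cluster"
    and \<gamma> y :: "stream \<Rightarrow> 'u \<Rightarrow> real"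
    and \<nu> :: real
  assumes "\<And>j. gain C j \<ge> 0"
    and "noise C > 0"
    and "bandwidth C > 0"
    and "\<And>i. share C i \<ge> 0"
    and "(\<Sum>i\<in>UNIV. share C i) = 1"
    and "\<And>i. amp_eff C i > 0"
    and "slot C > 0"
    and "weight C > 0"
    and "\<And>j. min_rate C j \<ge> 0"
    and "\<And>s j. \<gamma> s j \<ge> 0"
    and "\<And>s j. y s j \<ge> 0"
    and "\<nu> \<ge> 0"
  shows "convex (feasible_set C \<gamma> y) \<and> concave_on (feasible_set C \<gamma> y) (objective C \<gamma> y \<nu>)"
proof
  show conv: "convex (feasible_set C \<gamma> y)"
    using assms by (intro convex_feasible_set)
  show "concave_on (feasible_set C \<gamma> y) (objective C \<gamma> y \<nu>)"
    unfolding concave_on_iff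
  proof (intro conjI conv ballI allI impI)
    fix x x' :: "real \<times> (real^'u) \<times> (real^'u) \<times> real" and u v :: real
    assume x: "x \<in> feasible_set C \<gamma> y" and x': "x' \<in> feasible_set C \<gamma> y"
      and uv: "u \<ge> 0" "v \<ge> 0" "u + v = 1"
    obtain pc p t rc where x_eq: "x = (pc, p, t, rc)" by (cases x) auto
    obtain pc' p' t' rc' where x'_eq: "x' = (pc', p', t', rc')" by (cases x') auto
    note mem = x[unfolded x_eq] and mem' = x'[unfolded x'_eq]
    let ?N = "total_rate C \<gamma> y pc p t" and ?N' = "total_rate C \<gamma> y pc' p' t'"
    let ?D = "total_power C pc p" and ?D' = "total_power C pc' p'"
    let ?L = "\<Sum>i\<in>UNIV. queue C i * load_power C i pc p"
    let ?L' = "\<Sum>i\<in>UNIV. queue C i * load_power C i pc' p'"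
    let ?Nuv = "total_rate C \<gamma> y (u * pc + v * pc') (u *\<^sub>R p + v *\<^sub>R p') (u *\<^sub>R t + v *\<^sub>R t')"
    have "u * sqrt ?N + v * sqrt ?N' \<le> sqrt (u * ?N + v * ?N')"
      using uv feasible_total_rate_nonneg[OF assms(3,9) mem]
        feasible_total_rate_nonneg[OF assms(3,9) mem']
      by (intro sqrt_convex_combination_ge)
    \<comment> \<open>Monotonicity of the root turns concavity of the total rate into concavity of
      its square root.\<close>
    also have "\<dots> \<le> sqrt ?Nuv"
      using assms uv feasible_signal_nonneg[OF assms(1) mem]
        feasible_signal_nonneg[OF assms(1) mem']
      by (intro real_sqrt_le_mono total_rate_combination_ge) auto
    finally have root: "u * sqrt ?N + v * sqrt ?N' \<le> sqrt ?Nuv" .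
    \<comment> \<open>An equality, not just an inequality, so negative queue weights do no
      harm.\<close>
    have load: "(\<Sum>i\<in>UNIV. queue C i * load_power C i (u * pc + v * pc') (u *\<^sub>R p + v *\<^sub>R p'))
        = u * ?L + v * ?L'"
      unfolding load_power_combination[OF uv(3)] sum_distrib_left sum.distrib[symmetric]
      by (intro sum.cong refl) (simp add: algebra_simps)
    have "u * objective C \<gamma> y \<nu> x + v * objective C \<gamma> y \<nu> x'
      = weight C * (2 * \<nu> * (u * sqrt ?N + v * sqrt ?N') - \<nu>\<^sup>2 * (u * ?D + v * ?D'))
        - slot C * (u * ?L + v * ?L')"
      unfolding objective_def x_eq x'_eq by (simp add: algebra_simps)
    also have "\<dots> \<le> weight C * (2 * \<nu> * sqrt ?Nuv - \<nu>\<^sup>2 * (u * ?D + v * ?D'))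
        - slot C * (u * ?L + v * ?L')"
      using root assms by (intro diff_right_mono mult_left_mono) auto
    also have "\<dots> = objective C \<gamma> y \<nu> (u *\<^sub>R x + v *\<^sub>R x')"
      unfolding objective_def x_eq x'_eq by (simp add: load total_power_combination[OF uv(3)])
    finally show "u * objective C \<gamma> y \<nu> x + v * objective C \<gamma> y \<nu> x'
        \<le> objective C \<gamma> y \<nu> (u *\<^sub>R x + v *\<^sub>R x')" .
  qed
qed

end
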